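(* Let $L>0$ and let $f:\mathbb{R}^n\to\mathbb{R}$ be a strictly convex function of class $C^1$ whose gradient is Lipschitz continuous with constant $L$, and assume that $f$ admits a unique minimizer $x^*\in\mathbb{R}^n$. Let $(x_k)_{k\ge0}\subset\mathbb{R}^n$ be the sequence produced by the algorithm RCM-grad (described in the context), from a starting point $x_0\in\mathbb{R}^n$, with time-step $h$ satisfying $0<h<\frac{\sqrt2}{\sqrt L}$. Then the sequence $(x_k)_{k\ge 0}$ converges to the minimizer $x^*$.
   Context: The Restart-Conservative Method with gradient restart (RCM-grad) with time-step $h>0$ and starting point $x_0\in\mathbb{R}^n$ generates sequences $(x_k)_{k\ge0}$, $(v_k)_{k\ge0}$ in $\mathbb{R}^n$ as follows. Set $v_0=0$. For every $k\ge0$, compute $x'=x_k-h^2\nabla f(x_k)+h v_k$. - If $\nabla f(x')\cdot v_k>0$ (restart), set $x_{k+1}=x_k-h^2\nabla f(x_k)$ and $v_{k+1}=-h\nabla f(x_k)$. - Otherwise, set $x_{k+1}=x'$ and $v_{k+1}=v_k-h\nabla f(x_k)$. The iteration is run indefinitely (no cap on the number of iterations). *)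

theory Defs
  imports "HOL-Analysis.Analysis"
begin

definition gradient :: "('a::euclidean_space \<Rightarrow> real) \<Rightarrow> 'a \<Rightarrow> 'a" where
  "gradient f x = (THE D. GDERIV f x :> D)"

lemma gradient_eqI:
  assumes "GDERIV f x :> D"
  shows "gradient f x = D"
  unfolding gradient_def
proof (rule the_equality)
  fix E assume "GDERIV f x :> E"
  with assms have "(\<lambda>y. y \<bullet> E) = (\<lambda>y. y \<bullet> D)"
    unfolding gderiv_def by (metis has_derivative_unique)
  then show "E = D"
    by (metis euclidean_eqI inner_commute)
qed (fact assms)

lemma GDERIV_gradient:
  assumes "f differentiable (at x)"
  shows "GDERIV f x :> gradient f x"
proof -
  obtain f' where f': "(f has_derivative f') (at x)"
    using assms unfolding differentiable_def by blast
  then have "linear f'"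
    by (rule has_derivative_linear)
  then have "f' = (\<lambda>y. y \<bullet> adjoint f' 1)"
    using adjoint_works[of f' _ "1::real"] by (auto simp: fun_eq_iff)
  with f' have "GDERIV f x :> adjoint f' 1"
    unfolding gderiv_def by simp
  then show ?thesis
    by (simp add: gradient_eqI)
qed

definition C1 :: "('a::euclidean_space \<Rightarrow> real) \<Rightarrow> bool" where
  "C1 f \<longleftrightarrow> (\<forall>x. f differentiable (at x)) \<and> continuous_on UNIV (gradient f)"

definition strictly_convex :: "('a::real_vector \<Rightarrow> real) \<Rightarrow> bool" where
  "strictly_convex f \<longleftrightarrow>
     (\<forall>x y u v. x \<noteq> y \<longrightarrow> 0 < u \<longrightarrow> 0 < v \<longrightarrow> u + v = 1 \<longrightarrow>
        f (u *\<^sub>R x + v *\<^sub>R y) < u * f x + v * f y)"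

definition unique_minimizer :: "('a \<Rightarrow> real) \<Rightarrow> 'a \<Rightarrow> bool" where
  "unique_minimizer f m \<longleftrightarrow>
     is_arg_min f (\<lambda>_. True) m \<and> (\<forall>y. is_arg_min f (\<lambda>_. True) y \<longrightarrow> y = m)"

definition rcm_grad_step ::
  "('a::euclidean_space \<Rightarrow> real) \<Rightarrow> real \<Rightarrow> 'a \<Rightarrow> 'a \<Rightarrow> 'a \<times> 'a" where
  "rcm_grad_step f h x v =
     (let x' = x - h\<^sup>2 *\<^sub>R gradient f x + h *\<^sub>R v in
      if gradient f x' \<bullet> v > 0
      then (x - h\<^sup>2 *\<^sub>R gradient f x, - h *\<^sub>R gradient f x)
      else (x', v - h *\<^sub>R gradient f x))"

text \<open>The pair \<open>(x\<^sub>k, v\<^sub>k)\<close> of position and velocity after \<open>k\<close> iterations.\<close>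

primrec rcm_grad ::
  "('a::euclidean_space \<Rightarrow> real) \<Rightarrow> real \<Rightarrow> 'a \<Rightarrow> nat \<Rightarrow> 'a \<times> 'a" where
  "rcm_grad f h x0 0 = (x0, 0)"
| "rcm_grad f h x0 (Suc k) =
     rcm_grad_step f h (fst (rcm_grad f h x0 k)) (snd (rcm_grad f h x0 k))"

end

(*
  Every iteration, restarted or not, has the form x' = x - h^2 grad f x + h w with grad f x' . w <= 0,
  where w = v without restart and w = 0 with one.  Write a = grad f x and b = grad f x'.
  Co-coercivity, f x >= f x' + b . (x - x') + |a - b|^2 / (2 L), then gives
    f x' <= f x - (h^2 / 4) |a + b|^2 - (1 / (2 L) - h^2 / 4) |a - b|^2,
  and both coefficients are positive because h^2 < 2 / L.  By the parallelogram law f x decreases by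
  at least a fixed multiple of |a|^2, so grad f (x_k) tends to 0.  If x stays at distance at least e
  from the minimizer m, then convexity bounds |grad f x| from below by (min f - f m) / e, the minimum
  being taken over the sphere of radius e around m; hence x_k tends to m.
*)
theory Submission
  imports Defs
begin

lemma GDERIV_along_line:
  assumes "\<And>x. GDERIV f x :> g x"
  shows "((\<lambda>t. f (x + t *\<^sub>R d)) has_real_derivative g (x + t *\<^sub>R d) \<bullet> d) (at t within S)"
proof -
  have "((\<lambda>t. x + t *\<^sub>R d) has_derivative (\<lambda>s. s *\<^sub>R d)) (at t within S)"
    by (auto intro!: derivative_eq_intros)
  moreover have "(f has_derivative (\<lambda>y. y \<bullet> g (x + t *\<^sub>R d))) (at (x + t *\<^sub>R d))"
    using assms by (simp add: gderiv_def)
  ultimately have "((\<lambda>t. f (x + t *\<^sub>R d)) has_derivative (\<lambda>s. s *\<^sub>R d \<bullet> g (x + t *\<^sub>R d)))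
      (at t within S)"
    by (rule has_derivative_compose)
  then show ?thesis
    by (rule has_derivative_imp_has_field_derivative) (simp add: inner_commute)
qed

text \<open>Along the line through \<open>x\<close> and \<open>y\<close>, \<open>f\<close> becomes a
  convex function of one real variable; its tangent at parameter 0, evaluated at 1, gives the
  bound.\<close>

lemma convex_on_above_gradient:
  assumes "convex_on UNIV f" and "\<And>x. GDERIV f x :> g x"
  shows "f y \<ge> f x + g x \<bullet> (y - x)"
proof -
  let ?\<phi> = "\<lambda>t. f (x + t *\<^sub>R (y - x))"
  have "convex_on UNIV ?\<phi>"
  proof (rule convex_onI)
    fix t a b :: real
    assume "0 < t" "t < 1"
    have "x + ((1 - t) *\<^sub>R a + t *\<^sub>R b) *\<^sub>R (y - x)
        = (1 - t) *\<^sub>R (x + a *\<^sub>R (y - x)) + t *\<^sub>R (x + b *\<^sub>R (y - x))"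
      by (simp add: algebra_simps)
    then show "?\<phi> ((1 - t) *\<^sub>R a + t *\<^sub>R b) \<le> (1 - t) * ?\<phi> a + t * ?\<phi> b"
      using convex_onD[OF assms(1), of t] \<open>0 < t\<close> \<open>t < 1\<close> by simp
  qed simp
  from convex_on_imp_above_tangent[OF this, where c = 0 and x = 1, OF _ _ _ GDERIV_along_line[OF assms(2)]]
  show ?thesis by simp
qed

text \<open>Cauchy-Schwarz and the Lipschitz bound make the derivative of \<open>?\<psi>\<close>
  nonpositive on the unit interval, so \<open>?\<psi>\<close> at 1 does not exceed its value at
  0.\<close>

lemma lipschitz_gradient_descent:
  fixes f :: "'a::real_inner \<Rightarrow> real"
  assumes "\<And>x. GDERIV f x :> g x" and "L-lipschitz_on UNIV g"
  shows "f y \<le> f x + g x \<bullet> (y - x) + L / 2 * (norm (y - x))\<^sup>2"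
proof -
  define d where "d = y - x"
  let ?\<psi> = "\<lambda>t. f (x + t *\<^sub>R d) - t * (g x \<bullet> d) - L / 2 * t\<^sup>2 * (norm d)\<^sup>2"
  have "?\<psi> 1 \<le> ?\<psi> 0"
  proof (rule DERIV_nonpos_imp_nonincreasing[where f = ?\<psi>])
    fix t :: real
    assume t: "0 \<le> t" "t \<le> 1"
    let ?D = "g (x + t *\<^sub>R d) \<bullet> d - g x \<bullet> d - L * t * (norm d)\<^sup>2"
    have "(?\<psi> has_real_derivative ?D) (at t)"
      by (auto intro!: derivative_eq_intros GDERIV_along_line[OF assms(1)])
    moreover have "?D \<le> 0"
    proof -
      have "g (x + t *\<^sub>R d) \<bullet> d - g x \<bullet> d \<le> norm (g (x + t *\<^sub>R d) - g x) * norm d"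
        by (metis inner_diff_left norm_cauchy_schwarz)
      also have "\<dots> \<le> L * norm (t *\<^sub>R d) * norm d"
        using lipschitz_onD[OF assms(2), of "x + t *\<^sub>R d" x]
        by (intro mult_right_mono) (simp_all add: dist_norm)
      finally show ?thesis
        using t by (simp add: power2_eq_square mult_ac)
    qed
    ultimately show "\<exists>D. (?\<psi> has_real_derivative D) (at t) \<and> D \<le> 0"
      by blast
  qed simp
  then show ?thesis
    by (simp add: d_def)
qed

text \<open>An auxiliary point \<open>z\<close> is bounded from below by the tangent at
  \<open>x\<close> and from above by the descent estimate at \<open>y\<close>; chaining the two
  bounds leaves the quadratic surplus.\<close>

lemma convex_lipschitz_gradient_lower_bound:
  fixes f :: "'a::real_inner \<Rightarrow> real"
  assumes "L > 0" and "convex_on UNIV f" and df: "\<And>x. GDERIV f x :> g x"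
    and lip: "L-lipschitz_on UNIV g"
  shows "f y \<ge> f x + g x \<bullet> (y - x) + (norm (g y - g x))\<^sup>2 / (2 * L)"
proof -
  define e where "e = g y - g x"
  \<comment> \<open>A gradient step from \<open>y\<close> for \<open>\<lambda>z. f z - g x \<bullet> z\<close>, which is minimal at \<open>x\<close>.\<close>
  define z where "z = y - (1 / L) *\<^sub>R e"
  have "f x + g x \<bullet> (z - x) \<le> f z"
    by (rule convex_on_above_gradient[OF assms(2) df])
  also have "f z \<le> f y + g y \<bullet> (z - y) + L / 2 * (norm (z - y))\<^sup>2"
    by (rule lipschitz_gradient_descent[OF df lip])
  finally have "f x + g x \<bullet> (y - x) + e \<bullet> (y - z) - L / 2 * (norm (z - y))\<^sup>2 \<le> f y"
    by (simp add: e_def inner_diff_left inner_diff_right)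
  moreover have "e \<bullet> (y - z) = (norm e)\<^sup>2 / L"
    by (simp add: z_def power2_norm_eq_inner)
  moreover have "L / 2 * (norm (z - y))\<^sup>2 = (norm e)\<^sup>2 / (2 * L)"
    using \<open>L > 0\<close> by (simp add: z_def power_divide) (simp add: field_simps power2_eq_square)
  moreover have "(norm e)\<^sup>2 / L = 2 * ((norm e)\<^sup>2 / (2 * L))"
    by simp
  ultimately show ?thesis
    unfolding e_def by linarith
qed

lemma corrected_gradient_step_decrease:
  fixes f :: "'a::real_inner \<Rightarrow> real"
  assumes "L > 0" and "convex_on UNIV f" and "\<And>x. GDERIV f x :> g x"
    and "L-lipschitz_on UNIV g"
    and "h \<ge> 0" and y: "y = x - h\<^sup>2 *\<^sub>R g x + h *\<^sub>R w" and "g y \<bullet> w \<le> 0"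
    and c: "c \<ge> 0" "c \<le> h\<^sup>2 / 4" "c \<le> 1 / (2 * L) - h\<^sup>2 / 4"
  shows "f y + 2 * c * (norm (g x))\<^sup>2 \<le> f x"
proof -
  define a b where "a = g x" and "b = g y"
  have "f y + b \<bullet> (x - y) + (norm (a - b))\<^sup>2 / (2 * L) \<le> f x"
    unfolding a_def b_def by (rule convex_lipschitz_gradient_lower_bound[OF assms(1-4)])
  moreover have "b \<bullet> (x - y) = h\<^sup>2 * (a \<bullet> b) - h * (b \<bullet> w)"
    by (simp add: y a_def inner_diff_right inner_commute algebra_simps)
  moreover have "h * (b \<bullet> w) \<le> 0"
    using assms(5,7) by (simp add: b_def mult_nonneg_nonpos)
  \<comment> \<open>Polarization turns the inner product, whose sign is unknown, into squares with
    nonnegative coefficients.\<close>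
  moreover have "h\<^sup>2 * (a \<bullet> b) + (norm (a - b))\<^sup>2 / (2 * L)
      = h\<^sup>2 / 4 * (norm (a + b))\<^sup>2 + (1 / (2 * L) - h\<^sup>2 / 4) * (norm (a - b))\<^sup>2"
  proof -
    have "(norm (a + b))\<^sup>2 = (norm (a - b))\<^sup>2 + 4 * (a \<bullet> b)"
      by (simp add: power2_norm_eq_inner inner_add inner_diff inner_commute)
    then show ?thesis
      by (simp add: algebra_simps)
  qed
  moreover have "c * (norm (a + b))\<^sup>2 \<le> h\<^sup>2 / 4 * (norm (a + b))\<^sup>2"
    and "c * (norm (a - b))\<^sup>2 \<le> (1 / (2 * L) - h\<^sup>2 / 4) * (norm (a - b))\<^sup>2"
    using c by (intro mult_right_mono; simp)+
  \<comment> \<open>With \<open>c\<close> below both coefficients, the parallelogram law applies;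
    the term in \<open>b\<close> is then dropped.\<close>
  moreover have "c * (norm (a + b))\<^sup>2 + c * (norm (a - b))\<^sup>2 = 2 * c * (norm a)\<^sup>2 + 2 * c * (norm b)\<^sup>2"
    by (simp add: power2_norm_eq_inner inner_add inner_diff inner_commute algebra_simps)
  moreover have "0 \<le> 2 * c * (norm b)\<^sup>2"
    using c by simp
  ultimately show ?thesis
    unfolding a_def by linarith
qed

lemma tendsto_unique_minimizer_if_gradient_tendsto_0:
  fixes f :: "'a::euclidean_space \<Rightarrow> real"
  assumes "convex_on UNIV f" and df: "\<And>x. GDERIV f x :> g x"
    and m: "unique_minimizer f m" and "((\<lambda>k. g (X k)) \<longlongrightarrow> 0) F"
  shows "(X \<longlongrightarrow> m) F"
proof (rule tendstoI)
  fix e :: real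
  assume "e > 0"
  \<comment> \<open>Equality would make \<open>z\<close> a second minimizer.\<close>
  have less: "f m < f z" if "z \<noteq> m" for z
    using m that unfolding unique_minimizer_def is_arg_min_linorder by (metis linorder_not_le order_trans)
  have "continuous_on UNIV f"
    using df unfolding gderiv_def
    by (meson continuous_at_imp_continuous_on has_derivative_continuous)
  then obtain s where s: "s \<in> sphere m e" "\<And>z. z \<in> sphere m e \<Longrightarrow> f s \<le> f z"
    using continuous_attains_inf[OF compact_sphere, of m e f] \<open>e > 0\<close>
    by (metis continuous_on_subset not_less_iff_gr_or_eq sphere_eq_empty subset_UNIV)
  define \<delta> where "\<delta> = f s - f m"
  have "\<delta> > 0"
    using less[of s] s \<open>e > 0\<close> by (auto simp: \<delta>_def)
  \<comment> \<open>The segment from \<open>m\<close> to \<open>x\<close> meets the sphere at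
    fraction \<open>t\<close> = \<open>e / r\<close>. Convexity there forces
    \<open>f x - f m\<close> to be at least \<open>\<delta> / t\<close>, while the tangent at
    \<open>x\<close> bounds it by \<open>norm (g x) * r\<close>.\<close>
  have far: "\<delta> / e \<le> norm (g x)" if "e \<le> dist x m" for x
  proof -
    define r where "r = norm (x - m)"
    define t where "t = e / r"
    have r: "e \<le> r"
      using that by (simp add: r_def dist_norm)
    then have t: "0 \<le> t" "t \<le> 1" "t * r = e"
      using \<open>e > 0\<close> by (simp_all add: t_def)
    have "m - ((1 - t) *\<^sub>R m + t *\<^sub>R x) = - (t *\<^sub>R (x - m))"
      by (simp add: algebra_simps)
    then have "(1 - t) *\<^sub>R m + t *\<^sub>R x \<in> sphere m e"
      using t by (simp add: dist_norm r_def)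
    then have "f s \<le> (1 - t) * f m + t * f x"
      using s(2) convex_onD[OF assms(1) t(1,2), of m x] by fastforce
    then have "\<delta> \<le> t * (f x - f m)"
      by (simp add: \<delta>_def algebra_simps)
    also have "f x - f m \<le> g x \<bullet> (x - m)"
      using convex_on_above_gradient[OF assms(1) df, of x m] by (simp add: inner_diff_right)
    then have "t * (f x - f m) \<le> t * (norm (g x) * r)"
      using t norm_cauchy_schwarz[of "g x" "x - m"] unfolding r_def
      by (intro mult_left_mono) auto
    also have "\<dots> = norm (g x) * e"
      by (simp flip: t(3))
    finally show ?thesis
      using \<open>e > 0\<close> by (simp add: divide_simps)
  qed
  have "\<forall>\<^sub>F k in F. norm (g (X k)) < \<delta> / e"
    using tendstoD[OF assms(4), of "\<delta> / e"] \<open>\<delta> > 0\<close> \<open>e > 0\<close> by simp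
  then show "\<forall>\<^sub>F k in F. dist (X k) m < e"
    by eventually_elim (meson far linorder_not_less)
qed

text \<open>Puts both branches in one form: without restart the sign condition is the negated
  restart test, and with restart it is trivial for \<open>w\<close> = 0, although the new point is
  not the tested one.\<close>

lemma rcm_grad_step_cases:
  obtains w where "fst (rcm_grad_step f h x v) = x - h\<^sup>2 *\<^sub>R gradient f x + h *\<^sub>R w"
    and "gradient f (fst (rcm_grad_step f h x v)) \<bullet> w \<le> 0"
proof (cases "gradient f (x - h\<^sup>2 *\<^sub>R gradient f x + h *\<^sub>R v) \<bullet> v > 0")
  case True
  then show ?thesis
    by (intro that[of 0]) (simp_all add: rcm_grad_step_def)
next
  case False
  then show ?thesis
    by (intro that[of v]) (simp_all add: rcm_grad_step_def)
qed

lemma strictly_convex_imp_convex_on: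
  assumes "strictly_convex f"
  shows "convex_on UNIV f"
proof (rule convex_onI)
  fix t x y
  assume "0 < t" "t < (1::real)"
  then show "f ((1 - t) *\<^sub>R x + t *\<^sub>R y) \<le> (1 - t) * f x + t * f y"
  proof (cases "x = y")
    case True
    then show ?thesis by (simp flip: scaleR_left.add add: algebra_simps)
  next
    case False
    with \<open>0 < t\<close> \<open>t < 1\<close> show ?thesis
      using assms unfolding strictly_convex_def by (simp add: less_imp_le)
  qed
qed simp

theorem theorem4p4:
  fixes f :: "real ^ 'n \<Rightarrow> real" and xstar x0 :: "real ^ 'n" and L h :: real
  assumes "L > 0"
    and "strictly_convex f"
    and "C1 f"
    and "L-lipschitz_on UNIV (gradient f)"
    and "unique_minimizer f xstar"
    and "0 < h" and "h < sqrt 2 / sqrt L"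
  shows "(\<lambda>k. fst (rcm_grad f h x0 k)) \<longlonglongrightarrow> xstar"
proof -
  let ?g = "gradient f"
  let ?X = "\<lambda>k. fst (rcm_grad f h x0 k)"
  have cvx: "convex_on UNIV f"
    using assms(2) by (rule strictly_convex_imp_convex_on)
  have df: "GDERIV f x :> ?g x" for x
    using assms(3) by (auto simp: C1_def intro: GDERIV_gradient)
  have "h\<^sup>2 < (sqrt 2 / sqrt L)\<^sup>2"
    using assms(6,7) by (intro power_strict_mono) auto
  then have "h\<^sup>2 < 2 / L"
    using assms(1) by (simp add: power_divide)
  \<comment> \<open>The bound on \<open>h\<^sup>2\<close> just obtained is exactly positivity of the
    second argument of \<open>min\<close>.\<close>
  define c where "c = min (h\<^sup>2 / 4) (1 / (2 * L) - h\<^sup>2 / 4)"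
  have c: "c > 0" "c \<le> h\<^sup>2 / 4" "c \<le> 1 / (2 * L) - h\<^sup>2 / 4"
    unfolding c_def using assms(1,6) \<open>h\<^sup>2 < 2 / L\<close>
    by - (simp add: field_simps, (rule min.cobounded1 min.cobounded2)+)
  have step: "f (?X (Suc k)) + 2 * c * (norm (?g (?X k)))\<^sup>2 \<le> f (?X k)" for k
  proof -
    obtain w where w: "?X (Suc k) = ?X k - h\<^sup>2 *\<^sub>R ?g (?X k) + h *\<^sub>R w"
      "?g (?X (Suc k)) \<bullet> w \<le> 0"
      using rcm_grad_step_cases[of f h "?X k" "snd (rcm_grad f h x0 k)"] by auto
    show ?thesis
      by (rule corrected_gradient_step_decrease[OF assms(1) cvx df assms(4) _ w])
        (use \<open>0 < h\<close> c in simp_all)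
  qed
  have "f (?X (Suc k)) \<le> f (?X k)" for k
    using step[of k] c(1) by (smt (verit) mult_nonneg_nonneg zero_le_power2)
  then have "decseq (\<lambda>k. f (?X k))"
    by (rule decseq_SucI)
  moreover have "f xstar \<le> f (?X k)" for k
    using assms(5) by (simp add: unique_minimizer_def is_arg_min_linorder)
  ultimately obtain l where l: "(\<lambda>k. f (?X k)) \<longlonglongrightarrow> l"
    by (metis decseq_convergent)
  \<comment> \<open>The values decrease and are bounded below by the minimum, so consecutive
    differences vanish in the limit; by \<open>step\<close> they dominate the squared gradient norms
    up to the factor \<open>2 * c\<close>.\<close>
  have "(\<lambda>k. f (?X k) - f (?X (Suc k))) \<longlonglongrightarrow> l - l"
    using l LIMSEQ_Suc[OF l] by (rule tendsto_diff)
  then have "(\<lambda>k. (f (?X k) - f (?X (Suc k))) / (2 * c)) \<longlonglongrightarrow> 0"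
    by (intro tendsto_divide_zero) simp
  moreover have "(norm (?g (?X k)))\<^sup>2 \<le> (f (?X k) - f (?X (Suc k))) / (2 * c)" for k
    using step[of k] c(1) by (simp only: pos_le_divide_eq) (simp add: mult.commute algebra_simps)
  ultimately have "(\<lambda>k. (norm (?g (?X k)))\<^sup>2) \<longlonglongrightarrow> 0"
    by - (rule Lim_null_comparison, simp_all)
  then have "(\<lambda>k. ?g (?X k)) \<longlonglongrightarrow> 0"
    by (simp add: tendsto_norm_zero_iff)
  then show ?thesis
    by (rule tendsto_unique_minimizer_if_gradient_tendsto_0[OF cvx df assms(5)])
qed

end
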